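(* Let $\lambda\ge 1$ be real, let $\tau=\frac{1-\sqrt5}{2}$, and let $f(z)=z+\sum_{n=2}^\infty a_nz^n$ belong to the class $\mathcal{PSL}^\lambda_{\Sigma}(\tilde p(z))$. Then $$|a_{2}|\leq\frac{|\tau|}{\sqrt{(2\lambda-1)^2-(10\lambda^2-11\lambda+3)\tau}}$$ and $$|a_{3}|\leq\frac{|\tau|\left[(2\lambda-1)^{2}-2(5\lambda^{2}-4\lambda+1)\tau\right]}{(3\lambda-1)\left[(2\lambda-1)^{2}-(10\lambda^{2}-11\lambda+3)\tau\right]}.$$
   Context: Let $\mathbb U=\{z\in\mathbb C:|z|<1\}$. Consider functions $f$ analytic in $\mathbb U$ with $f(0)=0$, $f'(0)=1$, i.e. $f(z)=z+\sum_{n\ge2}a_nz^n$. Such an $f$ is bi-univalent, written $f\in\Sigma$, if $f$ is univalent (injective) in $\mathbb U$ and its inverse $f^{-1}$ (defined near $0$, with $f^{-1}(f(z))=z$) is also univalent in $\mathbb U$, i.e. it extends to a univalent analytic function $g$ on $\mathbb U$; then $g(w)=w-a_2w^2+(2a_2^2-a_3)w^3+\cdots$. Subordination: for analytic $F,G$ in $\mathbb U$, $F\prec G$ means that there is an analytic $\omega:\mathbb U\to\mathbb C$ with $\omega(0)=0$, $|\omega(z)|<1$ and $F(z)=G(\omega(z))$ for all $z\in\mathbb U$. Let $\tau=(1-\sqrt5)/2$ and $\tilde p(z)=\dfrac{1+\tau^2z^2}{1-\tau z-\tau^2z^2}$. For real $\lambda\ge1$, a function $f\in\Sigma$ is in the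 class $\mathcal{PSL}^\lambda_\Sigma(\tilde p(z))$ if, with $g=f^{-1}$, $$\frac{z(f'(z))^\lambda}{f(z)}\prec\tilde p(z)\quad\text{and}\quad\frac{w(g'(w))^\lambda}{g(w)}\prec\tilde p(w)\qquad(z,w\in\mathbb U).$$ The powers are the analytic branches with value $1$ at the origin, and the quotients are given their value $1$ at the origin. *)

theory Defs
  imports "HOL-Complex_Analysis.Complex_Analysis"
begin

abbreviation unit_disc :: "complex set" where
  "unit_disc \<equiv> ball 0 1"

definition univalent :: "(complex \<Rightarrow> complex) \<Rightarrow> bool" where
  "univalent f \<longleftrightarrow> f holomorphic_on unit_disc \<and> inj_on f unit_disc"

text \<open>The inverse of \<open>f\<close> is a priori only a germ at \<open>0\<close>. For \<open>f\<close> with \<open>f 0 = 0\<close> and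
  \<open>deriv f 0 = 1\<close>, the predicate says that \<open>g\<close> is a univalent extension of that germ to the
  unit disc; by the identity theorem \<open>g\<close> is unique on the disc.\<close>

definition univalent_inverse :: "(complex \<Rightarrow> complex) \<Rightarrow> (complex \<Rightarrow> complex) \<Rightarrow> bool" where
  "univalent_inverse f g \<longleftrightarrow> univalent g \<and> (\<forall>\<^sub>F z in nhds 0. g (f z) = z)"

definition bi_univalent :: "(complex \<Rightarrow> complex) set" where
  "bi_univalent = {f. univalent f \<and> f 0 = 0 \<and> deriv f 0 = 1 \<and> (\<exists>g. univalent_inverse f g)}"

text \<open>Intended for \<open>F\<close> and \<open>G\<close> holomorphic on the unit disc. The superordinate function \<open>G\<close> need
  not be univalent.\<close>

definition subordinate :: "(complex \<Rightarrow> complex) \<Rightarrow> (complex \<Rightarrow> complex) \<Rightarrow> bool" where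
  "subordinate F G \<longleftrightarrow>
     (\<exists>\<omega>. \<omega> holomorphic_on unit_disc \<and> \<omega> 0 = 0 \<and> (\<forall>z\<in>unit_disc. norm (\<omega> z) < 1) \<and>
          (\<forall>z\<in>unit_disc. F z = G (\<omega> z)))"

text \<open>The branch of \<open>log F\<close> on the unit disc that vanishes at \<open>0\<close>. It is not the composition
  of \<open>F\<close> with the principal branch \<open>Ln\<close>, as \<open>F\<close> may wind around \<open>0\<close>. The lemmas
  \<open>disc_log_exists\<close> and \<open>disc_log_unique\<close> below justify the use of choice.\<close>

definition disc_log :: "(complex \<Rightarrow> complex) \<Rightarrow> complex \<Rightarrow> complex" where
  "disc_log F = (SOME L. L holomorphic_on unit_disc \<and> L 0 = 0 \<and>
                         (\<forall>z\<in>unit_disc. exp (L z) = F z))"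

definition disc_powr :: "(complex \<Rightarrow> complex) \<Rightarrow> real \<Rightarrow> complex \<Rightarrow> complex" where
  "disc_powr F a z = exp (of_real a * disc_log F z)"

text \<open>The function \<open>z f'(z)\<^sup>\<lambda> / f(z)\<close>, with its removable singularity at \<open>0\<close> filled in,
  where \<open>\<lambda>\<close> is written \<open>lam\<close>.\<close>

definition psl_quotient :: "real \<Rightarrow> (complex \<Rightarrow> complex) \<Rightarrow> complex \<Rightarrow> complex" where
  "psl_quotient lam f z = (if z = 0 then 1 else z * disc_powr (deriv f) lam z / f z)"

definition PSL_class :: "real \<Rightarrow> (complex \<Rightarrow> complex) \<Rightarrow> (complex \<Rightarrow> complex) set" where
  "PSL_class lam \<phi> = {f \<in> bi_univalent.
     subordinate (psl_quotient lam f) \<phi> \<and>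
     (\<exists>g. univalent_inverse f g \<and> subordinate (psl_quotient lam g) \<phi>)}"

definition tau :: real where
  "tau = (1 - sqrt 5) / 2"

definition p_tilde :: "complex \<Rightarrow> complex" where
  "p_tilde z = (1 + (of_real tau)\<^sup>2 * z\<^sup>2) / (1 - of_real tau * z - (of_real tau)\<^sup>2 * z\<^sup>2)"

lemma disc_log_exists:
  assumes "univalent f" "deriv f 0 = 1"
  shows "\<exists>L. L holomorphic_on unit_disc \<and> L 0 = 0 \<and> (\<forall>z\<in>unit_disc. exp (L z) = deriv f z)"
proof -
  have f: "f holomorphic_on unit_disc" "inj_on f unit_disc"
    using assms(1) by (auto simp: univalent_def)
  have nz: "deriv f z \<noteq> 0" if "z \<in> unit_disc" for z
    using holomorphic_injective_imp_regular[OF f(1) open_ball f(2) that] .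
  have hd: "deriv f holomorphic_on unit_disc"
    by (rule holomorphic_deriv[OF f(1) open_ball])
  obtain h where h: "h holomorphic_on unit_disc" "\<And>z. z \<in> unit_disc \<Longrightarrow> exp (h z) = deriv f z"
    using holomorphic_logarithm_exists[OF convex_ball open_ball hd nz, of 0] by auto
  have "exp (h 0) = 1"
    using h(2)[of 0] assms(2) by simp
  then have "(\<lambda>z. h z - h 0) holomorphic_on unit_disc \<and> h 0 - h 0 = 0 \<and>
      (\<forall>z\<in>unit_disc. exp (h z - h 0) = deriv f z)"
    using h(1) h(2) by (intro conjI ballI) (simp_all add: exp_diff holomorphic_on_diff)
  then show ?thesis
    by (intro exI[of _ "\<lambda>z. h z - h 0"])
qed

lemma disc_log_unique:
  assumes "L holomorphic_on unit_disc" "L 0 = 0" "\<forall>z\<in>unit_disc. exp (L z) = F z"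
    and "M holomorphic_on unit_disc" "M 0 = 0" "\<forall>z\<in>unit_disc. exp (M z) = F z"
    and z: "z \<in> unit_disc"
  shows "L z = M z"
proof -
  have d: "deriv (\<lambda>z. L z - M z) w = 0" if w: "w \<in> unit_disc" for w
  proof -
    note L = holomorphic_derivI[OF assms(1) open_ball w, of UNIV]
      and M = holomorphic_derivI[OF assms(4) open_ball w, of UNIV]
    have "((\<lambda>z. exp (L z - M z)) has_field_derivative
            exp (L w - M w) * (deriv L w - deriv M w)) (at w)"
      by (rule DERIV_fun_exp[OF DERIV_diff[OF L M]])
    moreover have "((\<lambda>z. exp (L z - M z)) has_field_derivative 0) (at w)"
    proof (rule has_field_derivative_transform_within_open[of "\<lambda>_. 1" _ _ unit_disc])
      show "1 = exp (L x - M x)" if "x \<in> unit_disc" for x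
        using assms(3)[rule_format, OF that] assms(6)[rule_format, OF that]
        by (metis exp_diff exp_not_eq_zero divide_self)
    qed (use w in auto)
    ultimately have "deriv L w - deriv M w = 0"
      by (metis DERIV_unique exp_not_eq_zero mult_eq_0_iff)
    then show ?thesis
      using DERIV_imp_deriv[OF DERIV_diff[OF L M]] by simp
  qed
  have h: "(\<lambda>z. L z - M z) holomorphic_on unit_disc"
    using assms(1,4) by (intro holomorphic_intros)
  have "((\<lambda>z. L z - M z) has_field_derivative 0) (at w within unit_disc)" if "w \<in> unit_disc" for w
    using holomorphic_derivI[OF h open_ball that, of unit_disc] d[OF that] by simp
  then have "\<exists>c. \<forall>w\<in>unit_disc. L w - M w = c"
    by (rule has_field_derivative_zero_constant[OF convex_ball])
  then obtain c where c: "\<And>w. w \<in> unit_disc \<Longrightarrow> L w - M w = c"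
    by auto
  from c[of 0] c[OF z] show ?thesis using assms(2,5) by simp
qed

end

theory Submission
  imports Defs
begin

text \<open>
  Write \<open>g\<close> for the inverse of \<open>f\<close>. Comparing the power series in
  \<open>z f'(z)\<^sup>\<lambda> / f(z) = p (\<omega> z)\<close>, where \<open>p z = 1 + \<tau> z + 3 \<tau>\<^sup>2 z\<^sup>2 + \<dots>\<close> and
  \<open>\<omega> z = u\<^sub>1 z + u\<^sub>2 z\<^sup>2 + \<dots>\<close>, gives two equations for \<open>a\<^sub>2\<close> and \<open>a\<^sub>3\<close>. The same equations hold
  for \<open>g\<close>, whose coefficients are \<open>- a\<^sub>2\<close> and \<open>2 a\<^sub>2\<^sup>2 - a\<^sub>3\<close>, with some \<open>v\<^sub>1\<close> and \<open>v\<^sub>2\<close> in place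
  of \<open>u\<^sub>1\<close> and \<open>u\<^sub>2\<close>. The first-order equations read
  \<open>(2 \<lambda> - 1) a\<^sub>2 = \<tau> u\<^sub>1 = - \<tau> v\<^sub>1\<close>. In the sum of the second-order equations \<open>a\<^sub>3\<close> cancels;
  in their difference the terms in \<open>u\<^sub>1\<^sup>2\<close> and \<open>v\<^sub>1\<^sup>2\<close> cancel:

  \<^item> \<open>2 (10 \<lambda>\<^sup>2 - 11 \<lambda> + 3) a\<^sub>2\<^sup>2 = - \<tau> (u\<^sub>2 + v\<^sub>2)\<close>
  \<^item> \<open>2 (3 \<lambda> - 1) (a\<^sub>3 - a\<^sub>2\<^sup>2) = \<tau> (u\<^sub>2 - v\<^sub>2)\<close>

  The analytic input is the sharp form of the Schwarz lemma \<open>\<bar>u\<^sub>2\<bar> \<le> 1 - \<bar>u\<^sub>1\<bar>\<^sup>2\<close>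
  (\<open>Schwarz_second_coefficient\<close>). As \<open>\<bar>u\<^sub>1\<bar> = \<bar>v\<^sub>1\<bar>\<close> is a multiple of \<open>\<bar>a\<^sub>2\<bar>\<close>, it turns the
  first relation into a bound for \<open>\<bar>a\<^sub>2\<bar>\<^sup>2\<close>; this is where the summand \<open>(2 \<lambda> - 1)\<^sup>2\<close> of the
  denominator comes from. The second relation, with just \<open>\<bar>u\<^sub>2\<bar>, \<bar>v\<^sub>2\<bar> \<le> 1\<close>, puts \<open>a\<^sub>3\<close> within
  \<open>\<bar>\<tau>\<bar> / (3 \<lambda> - 1)\<close> of \<open>a\<^sub>2\<^sup>2\<close>, and adding the bound for \<open>\<bar>a\<^sub>2\<bar>\<^sup>2\<close> yields the stated bound for
  \<open>\<bar>a\<^sub>3\<bar>\<close>.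

  Every analytic function is represented near \<open>0\<close> by its formal power series, so that the
  coefficient comparisons are computations with formal series.
\<close>

(* The dollar sign is also the component selection of vectors, which makes coefficients of
   formal power series ambiguous. *)
unbundle no vec_syntax

section \<open>Low-order coefficients of power series\<close>

lemma fps_mult_nth_2: "(F * G) $ 2 = F $ 0 * G $ 2 + F $ 1 * G $ 1 + F $ 2 * G $ 0"
  for F G :: "'a::comm_ring_1 fps"
  by (simp add: fps_mult_nth eval_nat_numeral sum.atLeast0_atMost_Suc)

lemma fps_mult_nth_3:
  "(F * G) $ 3 = F $ 0 * G $ 3 + F $ 1 * G $ 2 + F $ 2 * G $ 1 + F $ 3 * G $ 0"
  for F G :: "'a::comm_ring_1 fps"
  by (simp add: fps_mult_nth eval_nat_numeral sum.atLeast0_atMost_Suc)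

lemma fps_compose_nth_low:
  fixes F G :: "'a::comm_ring_1 fps"
  assumes "G $ 0 = 0"
  shows "(F oo G) $ 1 = F $ 1 * G $ 1"
    and "(F oo G) $ 2 = F $ 1 * G $ 2 + F $ 2 * (G $ 1)\<^sup>2"
    and "(F oo G) $ 3 = F $ 1 * G $ 3 + 2 * F $ 2 * G $ 1 * G $ 2 + F $ 3 * (G $ 1) ^ 3"
  using assms
  by (simp_all add: fps_compose_nth eval_nat_numeral sum.atLeast0_atMost_Suc fps_mult_nth
      algebra_simps)

lemma inverse_fps_nth:
  fixes F G :: "'a::comm_ring_1 fps"
  assumes "G oo F = fps_X" "F $ 0 = 0" "F $ 1 = 1"
  shows "G $ 1 = 1" "G $ 2 = - (F $ 2)" "G $ 3 = 2 * (F $ 2)\<^sup>2 - F $ 3"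
proof -
  note c = fps_compose_nth_low[OF assms(2), of G, unfolded assms(1)]
  show 1: "G $ 1 = 1"
    using c(1) assms by simp
  show 2: "G $ 2 = - (F $ 2)"
    using c(2) 1 assms by (simp add: add_eq_0_iff2)
  show "G $ 3 = 2 * (F $ 2)\<^sup>2 - F $ 3"
    using c(3) 1 2 assms by (simp add: power2_eq_square algebra_simps add_eq_0_iff2)
qed

lemma holomorphic_disc_has_fps_expansion:
  assumes "F holomorphic_on unit_disc"
  shows "F has_fps_expansion fps_expansion F 0"
  by (rule has_fps_expansion_fps_expansion[OF open_ball _ assms]) simp

lemma has_fps_expansion_cong_disc:
  assumes "F has_fps_expansion A" "\<And>z. z \<in> unit_disc \<Longrightarrow> F z = G z"
  shows "G has_fps_expansion A"
proof -
  have "eventually (\<lambda>z. z \<in> unit_disc) (nhds 0)"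
    by (rule eventually_nhds_in_open) auto
  then have "\<forall>\<^sub>F z in nhds 0. F z = G z"
    by eventually_elim (rule assms(2))
  then show ?thesis
    using assms(1) has_fps_expansion_cong[OF _ refl] by blast
qed

section \<open>The second coefficient of a bounded function\<close>

text \<open>
  By the Schwarz lemma \<open>\<omega> z = z h(z)\<close> with \<open>h\<close> mapping the disc to itself, unless \<open>\<omega>\<close> is a
  rotation. The coefficients in question are \<open>h 0\<close> and \<open>h' 0\<close>, and the bound is the
  Schwarz-Pick inequality for \<open>h\<close> at \<open>0\<close>: apply the Schwarz lemma again, to \<open>h\<close> followed by the
  Moebius transformation of the disc that moves \<open>h 0\<close> to \<open>0\<close>.
\<close>

lemma Schwarz_second_coefficient:
  assumes hol: "\<omega> holomorphic_on unit_disc" and 0: "\<omega> 0 = 0"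
    and bd: "\<And>z. z \<in> unit_disc \<Longrightarrow> norm (\<omega> z) < 1"
    and W: "\<omega> has_fps_expansion W"
  shows "norm (W $ 2) \<le> 1 - (norm (W $ 1))\<^sup>2"
proof (cases "\<exists>\<alpha>. (\<forall>z. norm z < 1 \<longrightarrow> \<omega> z = \<alpha> * z) \<and> norm \<alpha> = 1")
  case True
  then obtain \<alpha> where \<alpha>: "\<And>z. norm z < 1 \<Longrightarrow> \<omega> z = \<alpha> * z" "norm \<alpha> = 1"
    by blast
  have "(\<lambda>z. \<alpha> * z) has_fps_expansion fps_const \<alpha> * fps_X"
    by (intro fps_expansion_intros)
  then have "\<omega> has_fps_expansion fps_const \<alpha> * fps_X"
    by (rule has_fps_expansion_cong_disc) (simp add: \<alpha>)
  then have "W = fps_const \<alpha> * fps_X"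
    using W fps_expansion_unique_complex by blast
  with \<alpha>(2) show ?thesis by simp
next
  case False
  have bd': "norm z < 1 \<Longrightarrow> norm (\<omega> z) < 1" for z
    using bd by simp
  note schwarz = Schwarz_Lemma[OF hol 0 bd']
  obtain h where h: "h holomorphic_on unit_disc" "\<And>z. norm z < 1 \<Longrightarrow> \<omega> z = z * h z"
    "deriv \<omega> 0 = h 0"
    using Schwarz3[OF hol 0] by blast
  (* Equality in the Schwarz lemma, at 0 or elsewhere, would make \<omega> a rotation. *)
  have hlt: "norm (h z) < 1" if z: "norm z < 1" for z
  proof (cases "z = 0")
    case True
    have "norm (deriv \<omega> 0) \<le> 1" "norm (deriv \<omega> 0) \<noteq> 1"
      using schwarz[of 0] False by auto
    with True h(3) show ?thesis by simp
  next
    case nz: False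
    have "norm (\<omega> z) \<le> norm z" "norm (\<omega> z) \<noteq> norm z"
      using schwarz[of z] False z nz by auto
    with nz show ?thesis by (simp add: h(2)[OF z] norm_mult)
  qed
  define H where "H = fps_expansion h 0"
  have H: "h has_fps_expansion H"
    unfolding H_def by (rule holomorphic_disc_has_fps_expansion[OF h(1)])
  have "(\<lambda>z. z * h z) has_fps_expansion fps_X * H"
    by (intro fps_expansion_intros H)
  then have "\<omega> has_fps_expansion fps_X * H"
    by (rule has_fps_expansion_cong_disc) (simp add: h)
  then have WH: "W = fps_X * H"
    using W fps_expansion_unique_complex by blast
  have W1: "W $ 1 = h 0" and W2: "W $ 2 = deriv h 0"
    using has_fps_expansion_imp_0_eq_fps_nth_0[OF H] fps_nth_fps_expansion[OF H, of 1]
    by (simp_all add: WH)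
  define c where "c = h 0"
  define k where "k = Moebius_function 0 c \<circ> h"
  have c: "norm c < 1"
    using hlt[of 0] by (simp add: c_def)
  have "k holomorphic_on unit_disc"
    unfolding k_def
    by (rule holomorphic_on_compose_gen[OF h(1) Moebius_function_holomorphic[OF c]])
      (use hlt in auto)
  moreover have "k 0 = 0"
    by (simp add: k_def c_def Moebius_function_eq_zero)
  moreover have "norm (k z) < 1" if "norm z < 1" for z
    using Moebius_function_norm_lt_1[OF c hlt[OF that]] by (simp add: k_def)
  ultimately have k1: "norm (deriv k 0) \<le> 1"
    using Schwarz_Lemma(2)[of k 0] by simp
  have cc: "1 - cnj c * c = of_real (1 - (norm c)\<^sup>2)"
    using complex_norm_square[of c] by (simp add: mult.commute)
  have pos: "0 < 1 - (norm c)\<^sup>2"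
    using c by (simp add: power_less_one_iff abs_square_less_1)
  then have nz: "1 - cnj c * c \<noteq> 0"
    unfolding cc by (metis less_irrefl of_real_eq_0_iff)
  have dh: "(h has_field_derivative deriv h 0) (at 0)"
    by (rule holomorphic_derivI[OF h(1) open_ball]) simp
  have k_eq: "k = (\<lambda>z. (h z - c) / (1 - cnj c * h z))"
    by (auto simp: k_def Moebius_function_simple)
  have "(k has_field_derivative deriv h 0 / (1 - cnj c * c)) (at 0)"
    unfolding k_eq
    by (rule derivative_eq_intros dh refl | use nz in \<open>simp add: c_def\<close>)+
  then have "deriv k 0 = deriv h 0 / (1 - cnj c * c)"
    by (rule DERIV_imp_deriv)
  with k1 have "norm (deriv h 0) / (1 - (norm c)\<^sup>2) \<le> 1"
    using pos unfolding cc by (simp add: norm_divide del: of_real_diff)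
  with pos show ?thesis
    unfolding W1 W2 c_def[symmetric] by simp
qed

section \<open>Coefficients of the quotient\<close>

text \<open>
  If \<open>L\<close> is the branch of \<open>log f'\<close>, then \<open>f'\<close> and its power are the values at \<open>c = 1\<close> and
  \<open>c = \<lambda>\<close> of the one family \<open>exp (c L)\<close>. The case \<open>c = 1\<close> expresses the coefficients of \<open>L\<close> in
  those of \<open>f\<close>, and the case \<open>c = \<lambda>\<close> then gives the power.
\<close>

lemma disc_powr_deriv_expansion:
  assumes f: "univalent f" "deriv f 0 = 1" and A: "f has_fps_expansion A"
  obtains E where "disc_powr (deriv f) lam has_fps_expansion E" "E $ 0 = 1"
    "E $ 1 = 2 * of_real lam * A $ 2"
    "E $ 2 = 3 * of_real lam * A $ 3 + 2 * of_real lam * (of_real lam - 1) * (A $ 2)\<^sup>2"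
proof -
  define L where "L = disc_log (deriv f)"
  have L: "L holomorphic_on unit_disc" "L 0 = 0" "\<And>z. z \<in> unit_disc \<Longrightarrow> exp (L z) = deriv f z"
    using someI_ex[OF disc_log_exists[OF f]] by (auto simp: L_def disc_log_def)
  define B where "B = fps_expansion L 0"
  have B: "L has_fps_expansion B"
    unfolding B_def by (rule holomorphic_disc_has_fps_expansion[OF L(1)])
  have B0: "B $ 0 = 0"
    using has_fps_expansion_imp_0_eq_fps_nth_0[OF B] L(2) by simp
  have expL: "(\<lambda>z. exp (c * L z)) has_fps_expansion (fps_exp c oo B)" for c
    using has_fps_expansion_compose[OF has_fps_expansion_exp[of c] B B0] by (simp add: o_def)
  have exp_nth: "(fps_exp c oo B) $ 1 = c * B $ 1"
    "(fps_exp c oo B) $ 2 = c * B $ 2 + c\<^sup>2 / 2 * (B $ 1)\<^sup>2" for c :: complex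
    by (simp_all add: fps_compose_nth_low[OF B0] del: One_nat_def)
  have "deriv f has_fps_expansion (fps_exp 1 oo B)"
    by (rule has_fps_expansion_cong_disc[OF expL]) (simp add: L)
  then have eq: "fps_deriv A = fps_exp 1 oo B"
    using has_fps_expansion_deriv[OF A] fps_expansion_unique_complex by blast
  have A2: "2 * A $ 2 = B $ 1"
    using arg_cong[OF eq, of "\<lambda>F. F $ 1"] unfolding exp_nth
    by (simp add: numeral_2_eq_2)
  have A3: "3 * A $ 3 = B $ 2 + (B $ 1)\<^sup>2 / 2"
    using arg_cong[OF eq, of "\<lambda>F. F $ 2"] unfolding exp_nth
    by (simp add: eval_nat_numeral)
  show thesis
  proof (rule that)
    show "disc_powr (deriv f) lam has_fps_expansion (fps_exp (of_real lam) oo B)"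
      using expL[of "of_real lam"] unfolding disc_powr_def L_def .
    show "(fps_exp (of_real lam) oo B) $ 0 = 1"
      by simp
    show "(fps_exp (of_real lam) oo B) $ 1 = 2 * of_real lam * A $ 2"
      unfolding exp_nth A2[symmetric] by simp
    have B2: "B $ 2 = 3 * A $ 3 - 2 * (A $ 2)\<^sup>2"
      using A3 unfolding A2[symmetric] by (simp add: power2_eq_square)
    show "(fps_exp (of_real lam) oo B) $ 2
        = 3 * of_real lam * A $ 3 + 2 * of_real lam * (of_real lam - 1) * (A $ 2)\<^sup>2"
      unfolding exp_nth B2 A2[symmetric] by (simp add: power2_eq_square algebra_simps)
  qed
qed

text \<open>
  Clearing the denominator turns the subordination into \<open>\<phi> (\<omega> z) f(z) = z f'(z)\<^sup>\<lambda>\<close>, which also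
  holds at \<open>0\<close> and compares two products of known series. The coefficient of \<open>z\<close> forces
  \<open>\<phi> 0 = 1\<close>; those of \<open>z\<^sup>2\<close> and \<open>z\<^sup>3\<close> are the two equations. The witnesses are the first two
  coefficients of \<open>\<omega>\<close>.
\<close>

lemma subordinate_psl_quotient_coefficients:
  fixes \<phi> :: "complex \<Rightarrow> complex"
  assumes f: "univalent f" "f 0 = 0" "deriv f 0 = 1" and A: "f has_fps_expansion A"
    and sub: "subordinate (psl_quotient lam f) \<phi>"
    and P: "\<phi> has_fps_expansion P"
  obtains u1 u2 where "norm u2 \<le> 1 - (norm u1)\<^sup>2"
    "(2 * of_real lam - 1) * A $ 2 = P $ 1 * u1"
    "(3 * of_real lam - 1) * A $ 3 + (2 * (of_real lam)\<^sup>2 - 4 * of_real lam + 1) * (A $ 2)\<^sup>2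
      = P $ 1 * u2 + P $ 2 * u1\<^sup>2"
proof -
  obtain \<omega> where \<omega>: "\<omega> holomorphic_on unit_disc" "\<omega> 0 = 0"
    "\<And>z. z \<in> unit_disc \<Longrightarrow> norm (\<omega> z) < 1"
    "\<And>z. z \<in> unit_disc \<Longrightarrow> psl_quotient lam f z = \<phi> (\<omega> z)"
    using sub unfolding subordinate_def by blast
  define W where "W = fps_expansion \<omega> 0"
  have W: "\<omega> has_fps_expansion W"
    unfolding W_def by (rule holomorphic_disc_has_fps_expansion[OF \<omega>(1)])
  have W0: "W $ 0 = 0"
    using has_fps_expansion_imp_0_eq_fps_nth_0[OF W] \<omega>(2) by simp
  obtain E where E: "disc_powr (deriv f) lam has_fps_expansion E" "E $ 0 = 1"
    "E $ 1 = 2 * of_real lam * A $ 2"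
    "E $ 2 = 3 * of_real lam * A $ 3 + 2 * of_real lam * (of_real lam - 1) * (A $ 2)\<^sup>2"
    using disc_powr_deriv_expansion[OF f(1,3) A] .
  have A0: "A $ 0 = 0" and A1: "A $ 1 = 1"
    using has_fps_expansion_imp_0_eq_fps_nth_0[OF A] fps_nth_fps_expansion[OF A, of 1] f
    by simp_all
  have Q: "(\<phi> \<circ> \<omega>) has_fps_expansion (P oo W)"
    by (rule has_fps_expansion_compose[OF P W W0])
  have "(\<phi> \<circ> \<omega>) z * f z = z * disc_powr (deriv f) lam z" if z: "z \<in> unit_disc" for z
  proof (cases "z = 0")
    case False
    with z f(1,2) have "f z \<noteq> 0"
      unfolding univalent_def by (metis centre_in_ball inj_onD zero_less_one)
    with False show ?thesis
      using \<omega>(4)[OF z] by (simp add: psl_quotient_def field_simps)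
  qed (simp add: f)
  with has_fps_expansion_mult[OF Q A]
  have "(\<lambda>z. z * disc_powr (deriv f) lam z) has_fps_expansion (P oo W) * A"
    by (rule has_fps_expansion_cong_disc)
  moreover have "(\<lambda>z. z * disc_powr (deriv f) lam z) has_fps_expansion fps_X * E"
    by (intro fps_expansion_intros E)
  ultimately have eq: "(P oo W) * A = fps_X * E"
    using fps_expansion_unique_complex by blast
  have P0: "P $ 0 = 1"
    using arg_cong[OF eq, of "\<lambda>F. F $ 1"] A0 A1 E(2) by simp
  have Q1: "P $ 1 * W $ 1 + A $ 2 = E $ 1"
    using arg_cong[OF eq, of "\<lambda>F. F $ 2"] A0 A1
    unfolding fps_mult_nth_2 fps_compose_nth_low[OF W0] by (simp add: P0 add.commute)
  have Q2: "(P $ 1 * W $ 2 + P $ 2 * (W $ 1)\<^sup>2) + P $ 1 * W $ 1 * A $ 2 + A $ 3 = E $ 2"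
    using arg_cong[OF eq, of "\<lambda>F. F $ 3"] A0 A1
    unfolding fps_mult_nth_3 fps_compose_nth_low[OF W0] by (simp add: P0 add_ac)
  have Q1': "P $ 1 * W $ 1 = (2 * of_real lam - 1) * A $ 2"
    using Q1 unfolding E by (simp add: algebra_simps)
  show thesis
  proof (rule that)
    show "norm (W $ 2) \<le> 1 - (norm (W $ 1))\<^sup>2"
      by (rule Schwarz_second_coefficient[OF \<omega>(1-3) W])
    show "(2 * of_real lam - 1) * A $ 2 = P $ 1 * W $ 1"
      using Q1' ..
    show "(3 * of_real lam - 1) * A $ 3
        + (2 * (of_real lam)\<^sup>2 - 4 * of_real lam + 1) * (A $ 2)\<^sup>2
      = P $ 1 * W $ 2 + P $ 2 * (W $ 1)\<^sup>2"
      using Q2 unfolding E Q1' by (simp add: algebra_simps power2_eq_square)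
  qed
qed

section \<open>The inverse function and the superordinate function\<close>

text \<open>
  The normalization \<open>g 0 = 0\<close>, \<open>g' 0 = 1\<close> comes out of the germ identity \<open>g (f z) = z\<close>; it makes
  the coefficient equations applicable to \<open>g\<close> as well.
\<close>

lemma univalent_inverse_expansion:
  assumes f: "f 0 = 0" "deriv f 0 = 1" and A: "f has_fps_expansion A"
    and inv: "univalent_inverse f g"
  obtains B where "g has_fps_expansion B" "g 0 = 0" "deriv g 0 = 1"
    "B $ 2 = - (A $ 2)" "B $ 3 = 2 * (A $ 2)\<^sup>2 - A $ 3"
proof -
  define B where "B = fps_expansion g 0"
  have B: "g has_fps_expansion B"
    unfolding B_def using inv
    by (intro holomorphic_disc_has_fps_expansion) (simp add: univalent_inverse_def univalent_def)
  have ev: "\<forall>\<^sub>F z in nhds 0. (g \<circ> f) z = z"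
    using inv by (simp add: univalent_inverse_def)
  have A0: "A $ 0 = 0" and A1: "A $ 1 = 1"
    using has_fps_expansion_imp_0_eq_fps_nth_0[OF A] fps_nth_fps_expansion[OF A, of 1] f
    by simp_all
  have "(\<lambda>z. z) has_fps_expansion (B oo A)"
    using has_fps_expansion_compose[OF B A A0] has_fps_expansion_cong[OF ev refl] by blast
  then have "B oo A = fps_X"
    using has_fps_expansion_fps_X fps_expansion_unique_complex by blast
  note BA = inverse_fps_nth[OF this A0 A1]
  show thesis
  proof (rule that[OF B _ _ BA(2,3)])
    show "g 0 = 0"
      using eventually_nhds_x_imp_x[OF ev] f(1) by simp
    show "deriv g 0 = 1"
      using fps_nth_fps_expansion[OF B, of 1] BA(1) by simp
  qed
qed

lemma p_tilde_expansion:
  obtains P where "p_tilde has_fps_expansion P"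
    "P $ 1 = of_real tau" "P $ 2 = 3 * (of_real tau)\<^sup>2"
proof -
  define c :: complex where "c = of_real tau"
  define N D where "N = 1 + fps_const (c\<^sup>2) * fps_X\<^sup>2"
    and "D = 1 - fps_const c * fps_X - fps_const (c\<^sup>2) * fps_X\<^sup>2"
  have D: "(\<lambda>z. 1 - c * z - c\<^sup>2 * z\<^sup>2) has_fps_expansion D"
    unfolding D_def by (intro fps_expansion_intros)
  have N: "(\<lambda>z. 1 + c\<^sup>2 * z\<^sup>2) has_fps_expansion N"
    unfolding N_def by (intro fps_expansion_intros)
  have Dn: "D $ 0 = 1" "D $ 1 = - c" "D $ 2 = - c\<^sup>2"
    by (simp_all add: D_def fps_X_power_nth)
  have Nn: "N $ 0 = 1" "N $ 1 = 0" "N $ 2 = c\<^sup>2"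
    by (simp_all add: N_def fps_X_power_nth)
  have P: "p_tilde has_fps_expansion N / D"
    using has_fps_expansion_divide'[OF N D] Dn(1) unfolding p_tilde_def c_def by simp
  have eq: "N / D * D = N"
    using Dn(1) by (simp add: fps_divide_unit mult.assoc inverse_mult_eq_1)
  have P0: "(N / D) $ 0 = 1"
    using arg_cong[OF eq, of "\<lambda>F. F $ 0"] Dn Nn by simp
  have P1: "(N / D) $ 1 = c"
    using arg_cong[OF eq, of "\<lambda>F. F $ 1"] unfolding fps_mult_nth_1 Dn Nn P0 by simp
  have P2: "(N / D) $ 2 = 3 * c\<^sup>2"
    using arg_cong[OF eq, of "\<lambda>F. F $ 2"] unfolding fps_mult_nth_2 Dn Nn P0 P1
    by (simp add: power2_eq_square)
  show thesis
    using that[OF P] P1 P2 by (simp add: c_def)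
qed

section \<open>The coefficient bounds\<close>

lemma tau_neg: "tau < 0"
  unfolding tau_def by simp

text \<open>
  The algebraic core. Its premises are the coefficient equations for \<open>f\<close> and for its inverse,
  the latter already written in the coefficients of \<open>f\<close>, with \<open>t\<close> for \<open>\<tau>\<close>.
\<close>

lemma coefficient_bounds:
  fixes a2 a3 u1 u2 v1 v2 :: complex and lam t :: real
  assumes lam: "lam \<ge> 1" and t: "t < 0"
    and u: "norm u2 \<le> 1 - (norm u1)\<^sup>2"
      "(2 * of_real lam - 1) * a2 = of_real t * u1"
      "(3 * of_real lam - 1) * a3 + (2 * (of_real lam)\<^sup>2 - 4 * of_real lam + 1) * a2\<^sup>2
        = of_real t * u2 + 3 * (of_real t)\<^sup>2 * u1\<^sup>2"
    and v: "norm v2 \<le> 1 - (norm v1)\<^sup>2"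
      "(2 * of_real lam - 1) * (- a2) = of_real t * v1"
      "(3 * of_real lam - 1) * (2 * a2\<^sup>2 - a3)
        + (2 * (of_real lam)\<^sup>2 - 4 * of_real lam + 1) * (- a2)\<^sup>2
        = of_real t * v2 + 3 * (of_real t)\<^sup>2 * v1\<^sup>2"
  defines "D \<equiv> (2 * lam - 1)\<^sup>2 - (10 * lam\<^sup>2 - 11 * lam + 3) * t"
  shows "norm a2 \<le> \<bar>t\<bar> / sqrt D"
    and "norm a3 \<le> \<bar>t\<bar> * ((2 * lam - 1)\<^sup>2 - 2 * (5 * lam\<^sup>2 - 4 * lam + 1) * t)
        / ((3 * lam - 1) * D)"
proof -
  define K where "K = 10 * lam\<^sup>2 - 11 * lam + 3"
  have "K = (2 * lam - 1) * (5 * lam - 3)"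
    by (simp add: K_def power2_eq_square algebra_simps)
  with lam have K: "K > 0"
    by simp
  have D_eq: "D = (2 * lam - 1)\<^sup>2 + K * \<bar>t\<bar>"
    using t by (simp add: D_def K_def)
  have "(2 * lam - 1)\<^sup>2 > 0"
    using lam by simp
  with K t have D: "D > 0"
    unfolding D_eq by (intro add_pos_pos mult_pos_pos) auto
  define m :: complex where "m = of_real (2 * lam - 1)"
  have u1: "of_real t * u1 = m * a2" and v1: "of_real t * v1 = - (m * a2)"
    using u(2) v(2) by (simp_all add: m_def)
  have u1sq: "3 * (of_real t)\<^sup>2 * u1\<^sup>2 = 3 * (m * a2)\<^sup>2"
    and v1sq: "3 * (of_real t)\<^sup>2 * v1\<^sup>2 = 3 * (m * a2)\<^sup>2"
    using arg_cong[OF u1, of "\<lambda>x. 3 * x\<^sup>2"] arg_cong[OF v1, of "\<lambda>x. 3 * x\<^sup>2"]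
    by (simp_all add: power_mult_distrib)
  (* Replacing u1 and v1 by multiples of a2 contributes 6 (2 lam - 1)^2 a2^2 to the sum, and
     2 lam (2 lam - 1) - 6 (2 lam - 1)^2 = - 2 K. *)
  have sum: "2 * of_real K * a2\<^sup>2 = - (of_real t * (u2 + v2))"
    using u(3) v(3) unfolding u1sq v1sq m_def K_def
    by (simp add: power2_eq_square) algebra
  have diff: "2 * of_real (3 * lam - 1) * (a3 - a2\<^sup>2) = of_real t * (u2 - v2)"
    using u(3) v(3) unfolding u1sq v1sq m_def
    by (simp add: power2_eq_square) algebra
  have nu1: "\<bar>t\<bar> * norm u1 = (2 * lam - 1) * norm a2"
    using arg_cong[OF u1, of norm] lam by (simp add: m_def norm_mult flip: of_real_diff of_real_mult)
  have nv1: "norm v1 = norm u1"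
    using arg_cong[OF v1, of norm] arg_cong[OF u1, of norm] t
    by (metis mult_cancel_left norm_minus_cancel norm_mult norm_of_real abs_eq_0 less_irrefl)
  have uv: "norm u2 + norm v2 \<le> 2 * (1 - (norm u1)\<^sup>2)"
    using u(1) v(1) nv1 by simp
  have "2 * K * (norm a2)\<^sup>2 = \<bar>t\<bar> * norm (u2 + v2)"
    using arg_cong[OF sum, of norm] K by (simp add: norm_mult norm_power)
  also have "\<dots> \<le> \<bar>t\<bar> * (2 * (1 - (norm u1)\<^sup>2))"
    using norm_triangle_ineq[of u2 v2] uv by (intro mult_left_mono) auto
  finally have "K * (norm a2)\<^sup>2 \<le> \<bar>t\<bar> * (1 - (norm u1)\<^sup>2)"
    by (simp add: algebra_simps)
  then have "\<bar>t\<bar> * (K * (norm a2)\<^sup>2) \<le> \<bar>t\<bar> * (\<bar>t\<bar> * (1 - (norm u1)\<^sup>2))"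
    by (rule mult_left_mono) simp
  also have "\<dots> = t\<^sup>2 - (\<bar>t\<bar> * norm u1)\<^sup>2"
    by (simp add: power2_eq_square algebra_simps)
  finally have a2D: "(norm a2)\<^sup>2 * D \<le> t\<^sup>2"
    unfolding nu1 D_eq by (simp add: power2_eq_square algebra_simps)
  then have a2sq: "(norm a2)\<^sup>2 \<le> t\<^sup>2 / D"
    using D by (simp add: pos_le_divide_eq)
  then have "norm a2 \<le> sqrt (t\<^sup>2 / D)"
    by (rule real_le_rsqrt)
  then show "norm a2 \<le> \<bar>t\<bar> / sqrt D"
    by (simp add: real_sqrt_divide)
  have "2 * (3 * lam - 1) * norm (a3 - a2\<^sup>2) = \<bar>t\<bar> * norm (u2 - v2)"
    using arg_cong[OF diff, of norm] lam
    by (simp add: norm_mult del: of_real_diff of_real_mult)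
  also have "norm (u2 - v2) \<le> 2"
    using norm_triangle_ineq4[of u2 v2] u(1) v(1)
    by (smt (verit) zero_le_power2)
  finally have "2 * (3 * lam - 1) * norm (a3 - a2\<^sup>2) \<le> \<bar>t\<bar> * 2"
    by (simp add: mult_left_mono)
  then have "norm (a3 - a2\<^sup>2) \<le> \<bar>t\<bar> / (3 * lam - 1)"
    using lam by (simp add: pos_le_divide_eq algebra_simps)
  moreover have "norm a3 \<le> norm (a3 - a2\<^sup>2) + (norm a2)\<^sup>2"
    using norm_triangle_ineq[of "a3 - a2\<^sup>2" "a2\<^sup>2"] by (simp add: norm_power)
  ultimately have "norm a3 \<le> \<bar>t\<bar> / (3 * lam - 1) + t\<^sup>2 / D"
    using a2sq by linarith
  also have "\<dots> = (\<bar>t\<bar> * D + t\<^sup>2 * (3 * lam - 1)) / ((3 * lam - 1) * D)"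
    using lam D by (simp add: add_frac_eq)
  also have "\<bar>t\<bar> * D + t\<^sup>2 * (3 * lam - 1)
      = \<bar>t\<bar> * ((2 * lam - 1)\<^sup>2 - 2 * (5 * lam\<^sup>2 - 4 * lam + 1) * t)"
    using t by (simp add: D_def power2_eq_square algebra_simps)
  finally show "norm a3 \<le> \<bar>t\<bar> * ((2 * lam - 1)\<^sup>2 - 2 * (5 * lam\<^sup>2 - 4 * lam + 1) * t)
        / ((3 * lam - 1) * D)" .
qed

theorem theorem2p4:
  fixes lam :: real and f :: "complex \<Rightarrow> complex" and a :: "nat \<Rightarrow> complex"
  assumes "lam \<ge> 1"
    and "\<And>z. z \<in> unit_disc \<Longrightarrow> (\<lambda>n. a (n + 2) * z ^ (n + 2)) sums (f z - z)"
    and "f \<in> PSL_class lam p_tilde"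
  shows "norm (a 2) \<le> \<bar>tau\<bar> / sqrt ((2 * lam - 1)\<^sup>2 - (10 * lam\<^sup>2 - 11 * lam + 3) * tau)
    \<and> norm (a 3) \<le> \<bar>tau\<bar> * ((2 * lam - 1)\<^sup>2 - 2 * (5 * lam\<^sup>2 - 4 * lam + 1) * tau)
        / ((3 * lam - 1) * ((2 * lam - 1)\<^sup>2 - (10 * lam\<^sup>2 - 11 * lam + 3) * tau))"
proof -
  define A where "A = Abs_fps (\<lambda>n. if n = 0 then 0 else if n = 1 then 1 else a n)"
  have "eventually (\<lambda>z. z \<in> unit_disc) (nhds 0)"
    by (rule eventually_nhds_in_open) auto
  then have "\<forall>\<^sub>F z in nhds 0. (\<lambda>n. A $ n * z ^ n) sums f z"
  proof eventually_elim
    case (elim z)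
    have "(\<lambda>n. A $ (n + 2) * z ^ (n + 2)) sums (f z - (\<Sum>i<2. A $ i * z ^ i))"
      using assms(2)[OF elim] by (simp add: A_def eval_nat_numeral)
    then show ?case
      by (subst (asm) sums_iff_shift) simp
  qed
  then have A: "f has_fps_expansion A"
    by (rule has_fps_expansionI)
  obtain g where f: "univalent f" "f 0 = 0" "deriv f 0 = 1"
    and subf: "subordinate (psl_quotient lam f) p_tilde"
    and g: "univalent_inverse f g" and subg: "subordinate (psl_quotient lam g) p_tilde"
    using assms(3) by (auto simp: PSL_class_def bi_univalent_def)
  obtain B where B: "g has_fps_expansion B" "g 0 = 0" "deriv g 0 = 1"
    "B $ 2 = - (A $ 2)" "B $ 3 = 2 * (A $ 2)\<^sup>2 - A $ 3"
    using univalent_inverse_expansion[OF f(2,3) A g] .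
  have ug: "univalent g"
    using g by (simp add: univalent_inverse_def)
  obtain P where P: "p_tilde has_fps_expansion P"
    "P $ 1 = of_real tau" "P $ 2 = 3 * (of_real tau)\<^sup>2"
    using p_tilde_expansion .
  obtain u1 u2 where u: "norm u2 \<le> 1 - (norm u1)\<^sup>2"
    "(2 * of_real lam - 1) * A $ 2 = P $ 1 * u1"
    "(3 * of_real lam - 1) * A $ 3 + (2 * (of_real lam)\<^sup>2 - 4 * of_real lam + 1) * (A $ 2)\<^sup>2
      = P $ 1 * u2 + P $ 2 * u1\<^sup>2"
    using subordinate_psl_quotient_coefficients[OF f A subf P(1)] .
  obtain v1 v2 where v: "norm v2 \<le> 1 - (norm v1)\<^sup>2"
    "(2 * of_real lam - 1) * B $ 2 = P $ 1 * v1"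
    "(3 * of_real lam - 1) * B $ 3 + (2 * (of_real lam)\<^sup>2 - 4 * of_real lam + 1) * (B $ 2)\<^sup>2
      = P $ 1 * v2 + P $ 2 * v1\<^sup>2"
    using subordinate_psl_quotient_coefficients[OF ug B(2,3,1) subg P(1)] .
  have "A $ 2 = a 2" "A $ 3 = a 3"
    by (simp_all add: A_def)
  then show ?thesis
    using coefficient_bounds[OF assms(1) tau_neg u[unfolded P(2,3)] v[unfolded P(2,3) B(4,5)]]
    by auto
qed

end
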